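(* In the standard Boolean circuit model (uniform families of polynomial-size, constant-fan-in circuits), no polylogarithmic-depth circuit family, and therefore no $\mathbf{NC}$ circuit family, can implement the HTR process, where "implement" is meant in the causal sense defined in the context (depth-$D$ circuits are interpreted as executions lasting $D$ units of causal time, and polylogarithmic depth means $D=\mathrm{polylog}(N)$ for HTR instances of depth $N$).
   Context: HTR process. Fix a constant $d\ge 2$ and let $T_{d,N}$ be the complete $d$-ary tree of depth $N$. An instance is a hierarchical address $\ell=(a_0,a_1,\ldots,a_N)$ with $a_0=1$ and $a_i\in\{0,1\}^{\lceil\log_2 d\rceil}$ for $1\le i\le N$ encoding one of $d$ children; it identifies a unique target leaf, and its encoding is $x=a_0\|a_1\|\cdots\|a_N$ of length $n=\Theta(N\log d)$. A single token, carrying a state in a finite set $S$ with $|S|=O(1)$, starts at the root. At step $i$, only the current token-holder may act: it evaluates a validation predicate $f_i:S\times\{0,1\}^{\lceil\log_2 d\rceil}\to\{0,1\}$, computable in $O(1)$ time, at $(s_i,a_i)$, where $s_i$ is the current token state. If the value is $1$ (and $i<N$), the state is updated locally to $s_{i+1}$ and the token is handed to the child indexed by $a_i$; if the value is $0$, execution halts and rejects. At step $N$ the outcome is accept if $f_N(s_N,a_N)=1$ and reject otherwise. Correctness means faithful completion of this prescribed $N$-step execution; no strict prefix of an execution with all prior validations successful suffices to determine the outcome. Although $x$ encodes the whole address, a relay learns the routing information relevant to its step only when the token arrives. Valid HTR executions. The address $M=(a_1,\ldots,a_N)$ is regarded as a random message uniform on $[d]^N$, with Shannon entropy $H(M)=N\log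 d$; $I$ denotes (conditional) mutual information. Causal time is an abstract discrete unit of parallel time. An execution is a strictly ordered cascade of hop boundaries $0\to1\to\cdots\to N$, where crossing boundary $i\to i+1$ means advancing the token from level $i$ to level $i+1$. $X_i^{(t)}$ denotes the system state conditioned on the token being at level $i$ after $t$ units of causal time. A valid execution respects: - Non-duplicable token: the token is unique, and at any causal time only the current token-holder may transmit information across a boundary; the token advances by at most one hop per unit of causal time. - Hop-by-hop causality: at time $0$, $M$ is known only at the root; all other agents are independent of $M$ at time $0$ and may acquire information about it only through successive token handoffs. Information about $M$ must traverse the boundaries in order and cannot be rerouted, duplicated or bypassed. - Finite-rate communication: each hop has capacity $C_i=\log d+O(1)$ bits per unit of causal time. Whenever boundary $i\to i+1$ is crossed at time $t$, $I\big(M;X_{i+1}^{(t+1)}\mid X_{i+1}^{(t)}\big)\le C_i$; otherwise $X_{i+1}^{(t+1)}=X_{i+1}^{(t)}$. An execution completing in $T$ units of causal time must reveal the routing information at the end of the chain: there is an estimate $\hat M=\hat M(X_N^{(T)})$ of $M$ with $\Pr[\hat M\ne M]=o(1)$ as $N\to\infty$. Causal interpretation of circuit depth. A depth-$D$ Boolean circuit is interpreted as a synchronous parallel computation executing for $D$ units of causal time, where circuit layer $t$ corresponds to causal time $t$, and information flows only forward from layer $t$ to layer $t+1$. The following constraints are imposed: (i) the token state is unique and non-duplicable; (ii) in each unit of causal time the execution may advance the token across at most one hop boundary $i\to i+1$ (or halt); (iii) any update across boundary $i\to i+1$ occurs only via the token crossing that boundary, the token's next state may depend only on its current local state and on the routing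 information $a_i$ given in the input, and the state transition during the crossing is restricted to what can be realized within one unit of causal time, i.e. within the finite per-time capacity bound $C_i$. Implementation. A circuit family implements the HTR process if, under this interpretation, the layer-by-layer evolution of the circuit corresponds to a valid HTR execution respecting hop-by-hop causality (at time $0$, $M$ is known only at the root, all other agents are independent of $M$ at time $0$ and acquire information about it only through successive token handoffs, and information about $M$ traverses the boundaries $0\to1\to\cdots\to N$ in order without being rerouted, duplicated or bypassed), finite-rate communication (whenever boundary $i\to i+1$ is crossed at time $t$, $I\big(M;X_{i+1}^{(t+1)}\mid X_{i+1}^{(t)}\big)\le C_i$ with $C_i=\log d+O(1)$, and otherwise $X_{i+1}^{(t+1)}=X_{i+1}^{(t)}$) and the non-duplicable token constraint (the token is unique, at any causal time only the current token-holder may transmit information across a boundary, and the token advances by at most one hop per unit of causal time). Thus a depth-$D$ circuit implementing HTR induces a valid HTR execution lasting at most $D$ units of causal time. *)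

theory Defs
  imports "HOL-Probability.Probability" "HOL-Library.Landau_Symbols"
begin

section \<open>Boolean circuits\<close>

text \<open>A circuit is a straight-line program: a list of gates, each reading only earlier gates.
  Conjunctions and disjunctions take any number of arguments; bounded fan-in is a separate
  condition. The empty ones are the Boolean constants, the unary ones copy a wire.\<close>

datatype gate = Input nat | Neg nat | Conj "nat list" | Disj "nat list"

type_synonym circuit = "gate list"

fun preds :: "gate \<Rightarrow> nat list" where
  "preds (Input j) = []"
| "preds (Neg j) = [j]"
| "preds (Conj js) = js"
| "preds (Disj js) = js"

definition wf_circuit :: "nat \<Rightarrow> circuit \<Rightarrow> bool" where
  "wf_circuit n C \<longleftrightarrow>
     (\<forall>g<length C. \<forall>h\<in>set (preds (C ! g)). h < g) \<and>
     (\<forall>j. Input j \<in> set C \<longrightarrow> j < n)"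

fun eval_gate :: "bool list \<Rightarrow> bool list \<Rightarrow> gate \<Rightarrow> bool" where
  "eval_gate x vs (Input j) = x ! j"
| "eval_gate x vs (Neg j) = (\<not> vs ! j)"
| "eval_gate x vs (Conj js) = (\<forall>j\<in>set js. vs ! j)"
| "eval_gate x vs (Disj js) = (\<exists>j\<in>set js. vs ! j)"

definition gate_values :: "circuit \<Rightarrow> bool list \<Rightarrow> bool list" where
  "gate_values C x = foldl (\<lambda>vs g. vs @ [eval_gate x vs g]) [] C"

text \<open>The depth of a gate is the length of a longest path ending in it.\<close>

definition gate_depths :: "circuit \<Rightarrow> nat list" where
  "gate_depths C = foldl (\<lambda>ds g. ds @ [if preds g = [] then 0
     else Suc (Max ((\<lambda>j. ds ! j) ` set (preds g)))]) [] C"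

definition depth :: "circuit \<Rightarrow> nat" where
  "depth C = Max (insert 0 (set (gate_depths C)))"

text \<open>Information flows only from one layer to the next one.\<close>

definition layered :: "circuit \<Rightarrow> bool" where
  "layered C \<longleftrightarrow> (\<forall>g<length C. \<forall>h\<in>set (preds (C ! g)).
     gate_depths C ! g = Suc (gate_depths C ! h))"


section \<open>Uniform circuit families\<close>

text \<open>Circuits are written as bit strings, with self-delimiting codes for numbers and lists.\<close>

fun bits_of_nat :: "nat \<Rightarrow> bool list" where
  "bits_of_nat n = (if n = 0 then [] else odd n # bits_of_nat (n div 2))"

declare bits_of_nat.simps [simp del]

definition code_list :: "('a \<Rightarrow> bool list) \<Rightarrow> 'a list \<Rightarrow> bool list" where
  "code_list c xs = concat (map (\<lambda>x. True # c x) xs) @ [False]"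

definition code_nat :: "nat \<Rightarrow> bool list" where
  "code_nat n = code_list (\<lambda>b. [b]) (bits_of_nat n)"

fun code_gate :: "gate \<Rightarrow> bool list" where
  "code_gate (Input j) = [False, False] @ code_nat j"
| "code_gate (Neg j) = [False, True] @ code_nat j"
| "code_gate (Conj js) = [True, False] @ code_list code_nat js"
| "code_gate (Disj js) = [True, True] @ code_list code_nat js"

definition code_circuit :: "circuit \<Rightarrow> bool list" where
  "code_circuit = code_list code_gate"

text \<open>A deterministic Turing transducer: a two-way read-only input tape holding a number in
  unary between end markers, one work tape, and a write-only output tape. Only the work tape
  is charged for space. A transition maps state, scanned input symbol and scanned work symbol
  to the new state, the written work symbol, the two head moves and an optional output bit.
  State 0 is initial, state 1 is halting, work symbol 0 is the blank.\<close>

datatype move = MLeft | MStay | MRight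

type_synonym transducer =
  "nat \<Rightarrow> nat \<Rightarrow> nat \<Rightarrow> nat \<times> nat \<times> move \<times> move \<times> bool option"

definition finite_transducer :: "transducer \<Rightarrow> bool" where
  "finite_transducer \<delta> \<longleftrightarrow> (\<exists>Q G. 2 \<le> Q \<and> 1 \<le> G \<and>
     (\<forall>q<Q. \<forall>a<3. \<forall>g<G. fst (\<delta> q a g) < Q \<and> fst (snd (\<delta> q a g)) < G))"

fun move_head :: "move \<Rightarrow> nat \<Rightarrow> nat" where
  "move_head MLeft p = p - 1"
| "move_head MStay p = p"
| "move_head MRight p = p + 1"

record config =
  state :: nat
  inhead :: nat
  work :: "nat \<Rightarrow> nat"
  whead :: nat
  outtape :: "bool list"

definition init_config :: config where
  "init_config = \<lparr>state = 0, inhead = 0, work = (\<lambda>_. 0), whead = 0, outtape = []\<rparr>"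

text \<open>Cell 0 of the input tape is the left end marker (symbol 0), cells 1 to \<open>n\<close> contain
  symbol 1, and cell \<open>n + 1\<close> is the right end marker (symbol 2).\<close>

definition input_symbol :: "nat \<Rightarrow> nat \<Rightarrow> nat" where
  "input_symbol n p = (if p = 0 then 0 else if p \<le> n then 1 else 2)"

definition step :: "transducer \<Rightarrow> nat \<Rightarrow> config \<Rightarrow> config" where
  "step \<delta> n c = (if state c = 1 then c else
     (case \<delta> (state c) (input_symbol n (inhead c)) (work c (whead c)) of
       (q, g, mi, mw, out) \<Rightarrow>
         \<lparr>state = q,
          inhead = min (n + 1) (move_head mi (inhead c)),
          work = (work c)(whead c := g),
          whead = move_head mw (whead c),
          outtape = outtape c @ (case out of None \<Rightarrow> [] | Some b \<Rightarrow> [b])\<rparr>))"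

definition run :: "transducer \<Rightarrow> nat \<Rightarrow> nat \<Rightarrow> config" where
  "run \<delta> n k = (step \<delta> n ^^ k) init_config"

definition logspace_uniform :: "(nat \<Rightarrow> circuit) \<Rightarrow> bool" where
  "logspace_uniform C \<longleftrightarrow> (\<exists>\<delta> (c::real). finite_transducer \<delta> \<and>
     (\<forall>n. \<exists>k. state (run \<delta> n k) = 1 \<and>
        outtape (run \<delta> n k) = code_circuit (C n) \<and>
        (\<forall>j\<le>k. real (whead (run \<delta> n j)) \<le> c * log 2 (real n + 2))))"

text \<open>The standard circuit model; a family is indexed by the input length.\<close>

definition standard_family :: "(nat \<Rightarrow> circuit) \<Rightarrow> bool" where
  "standard_family C \<longleftrightarrow>
     (\<forall>n. wf_circuit n (C n)) \<and>
     logspace_uniform C \<and>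
     (\<exists>k. (\<lambda>n. real (length (C n))) \<in> O(\<lambda>n. real n ^ k)) \<and>
     (\<exists>k. \<forall>n. \<forall>g\<in>set (C n). length (preds g) \<le> k)"

definition polylog :: "(nat \<Rightarrow> nat) \<Rightarrow> bool" where
  "polylog D \<longleftrightarrow> (\<exists>k. (\<lambda>n. real (D n)) \<in> O(\<lambda>n. ln (real n) ^ k))"

definition NC_family :: "(nat \<Rightarrow> circuit) \<Rightarrow> bool" where
  "NC_family C \<longleftrightarrow> standard_family C \<and> polylog (\<lambda>n. depth (C n))"


section \<open>The HTR process\<close>

text \<open>A message \<open>m = [a\<^sub>1, \<dots>, a\<^sub>N]\<close> lists the child indices on the path from the root to the
  target leaf. A tree node is identified with the list of child indices leading to it, so
  the node of that path at level \<open>i\<close> is \<open>take i m\<close> and the target leaf is \<open>m\<close> itself.\<close>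

type_synonym msg = "nat list"

definition messages :: "nat \<Rightarrow> nat \<Rightarrow> msg set" where
  "messages d N = {m. length m = N \<and> set m \<subseteq> {..<d}}"

definition width :: "nat \<Rightarrow> nat" where
  "width d = nat \<lceil>log 2 (real d)\<rceil>"

definition word :: "nat \<Rightarrow> nat \<Rightarrow> bool list" where
  "word d a = map (\<lambda>j. odd (a div 2 ^ j)) [0..<width d]"

text \<open>\<open>address d m i\<close> is \<open>a\<^sub>i\<close>; the component \<open>a\<^sub>0\<close> is the single bit 1.\<close>

definition address :: "nat \<Rightarrow> msg \<Rightarrow> nat \<Rightarrow> bool list" where
  "address d m i = (if i = 0 then [True] else word d (m ! (i - 1)))"

definition encoding :: "nat \<Rightarrow> msg \<Rightarrow> bool list" where
  "encoding d m = concat (map (address d m) [0..<Suc (length m)])"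

definition input_length :: "nat \<Rightarrow> nat \<Rightarrow> nat" where
  "input_length d N = 1 + N * width d"

text \<open>\<open>valid P N i\<close> is the predicate \<open>f\<^sub>i\<close> for instances of depth \<open>N\<close>. The state set does not
  depend on \<open>N\<close>, so these are functions on a domain of constant size, which makes them
  computable in constant time.\<close>

record 's htr =
  states :: "'s set"
  start :: 's
  valid :: "nat \<Rightarrow> nat \<Rightarrow> 's \<Rightarrow> bool list \<Rightarrow> bool"
  update :: "nat \<Rightarrow> nat \<Rightarrow> 's \<Rightarrow> bool list \<Rightarrow> 's"

fun htr_state :: "'s htr \<Rightarrow> nat \<Rightarrow> nat \<Rightarrow> msg \<Rightarrow> nat \<Rightarrow> 's" where
  "htr_state P d N m 0 = start P"
| "htr_state P d N m (Suc i) = update P N i (htr_state P d N m i) (address d m i)"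

definition validated :: "'s htr \<Rightarrow> nat \<Rightarrow> nat \<Rightarrow> msg \<Rightarrow> nat \<Rightarrow> bool" where
  "validated P d N m i \<longleftrightarrow> valid P N i (htr_state P d N m i) (address d m i)"

definition accepts :: "'s htr \<Rightarrow> nat \<Rightarrow> nat \<Rightarrow> msg \<Rightarrow> bool" where
  "accepts P d N m \<longleftrightarrow> (\<forall>i\<le>N. validated P d N m i)"

text \<open>The last condition says that no strict prefix with successful validations determines
  the outcome.\<close>

definition htr_process :: "nat \<Rightarrow> 's htr \<Rightarrow> bool" where
  "htr_process d P \<longleftrightarrow>
     finite (states P) \<and> start P \<in> states P \<and>
     (\<forall>N i. \<forall>s\<in>states P. \<forall>w. update P N i s w \<in> states P) \<and>
     (\<forall>N. \<forall>k<N. \<forall>m\<in>messages d N. (\<forall>i\<le>k. validated P d N m i) \<longrightarrow>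
        (\<exists>m1\<in>messages d N. \<exists>m2\<in>messages d N.
           take k m1 = take k m \<and> take k m2 = take k m \<and>
           accepts P d N m1 \<and> \<not> accepts P d N m2))"


section \<open>Valid executions\<close>

text \<open>The probability space is the uniform distribution on messages. An execution on instances
  of depth \<open>N\<close> consists of the tree node \<open>tok m t\<close> holding the token and the token state
  \<open>st m t\<close> at time \<open>t\<close> on message \<open>m\<close>, and of the random variables \<open>X i t\<close>, where \<open>X i t m\<close> is
  the system state at level \<open>i\<close> at time \<open>t\<close>. Uniqueness of the token is implicit in \<open>tok\<close> being
  a function. The token may wait, so crossing times may depend on the message.\<close>

definition crosses :: "(msg \<Rightarrow> nat \<Rightarrow> nat list) \<Rightarrow> nat \<Rightarrow> nat \<Rightarrow> msg \<Rightarrow> bool" where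
  "crosses tok i t m \<longleftrightarrow> length (tok m t) = i \<and> length (tok m (Suc t)) = Suc i"

text \<open>The step at level \<open>i\<close> validates \<open>a\<^sub>i\<close> in state \<open>s\<^sub>i\<close>; the hop to level \<open>i + 1\<close> leads to the
  next node of the addressed path. The validation at level \<open>N\<close> gives the outcome.\<close>

definition token_run ::
  "nat \<Rightarrow> 's htr \<Rightarrow> nat \<Rightarrow> nat \<Rightarrow> (msg \<Rightarrow> nat \<Rightarrow> nat list) \<Rightarrow> (msg \<Rightarrow> nat \<Rightarrow> 's) \<Rightarrow> bool" where
  "token_run d P N T tok st \<longleftrightarrow> (\<forall>m\<in>messages d N.
     tok m 0 = [] \<and> st m 0 = start P \<and>
     (\<forall>t<T. let i = length (tok m t); a = address d m i in
        (tok m (Suc t) = tok m t \<and> st m (Suc t) = st m t) \<or>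
        (i < N \<and> valid P N i (st m t) a \<and>
         tok m (Suc t) = tok m t @ [m ! i] \<and> st m (Suc t) = update P N i (st m t) a)) \<and>
     (let i = length (tok m T) in
        i = N \<or> \<not> valid P N i (st m T) (address d m i)))"

definition determined_on :: "'a set \<Rightarrow> ('a \<Rightarrow> 'b) \<Rightarrow> ('a \<Rightarrow> 'c) \<Rightarrow> bool" where
  "determined_on A Y Z \<longleftrightarrow> (\<exists>h. \<forall>m\<in>A. Y m = h (Z m))"

text \<open>Independence of two discrete random variables under the uniform distribution on \<open>A\<close>. The
  library's \<open>indep_var\<close> would force both to have the same type, hence the generated events.\<close>

definition indep_rvs :: "'a set \<Rightarrow> ('a \<Rightarrow> 'b) \<Rightarrow> ('a \<Rightarrow> 'c) \<Rightarrow> bool" where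
  "indep_rvs A Y Z \<longleftrightarrow> prob_space.indep_set (uniform_count_measure A)
     {Y -` B \<inter> A | B. True} {Z -` B \<inter> A | B. True}"

text \<open>Hop-by-hop causality: initially only the root knows anything about the message; the root
  receives nothing later on; while the token is at level \<open>i\<close>, whether it is handed over and
  what level \<open>i + 1\<close> learns depend only on the states of these two levels; and the token
  state is held by the level where the token is.\<close>

definition causal ::
  "nat \<Rightarrow> nat \<Rightarrow> nat \<Rightarrow> (nat \<Rightarrow> nat \<Rightarrow> msg \<Rightarrow> 'x) \<Rightarrow>
   (msg \<Rightarrow> nat \<Rightarrow> nat list) \<Rightarrow> (msg \<Rightarrow> nat \<Rightarrow> 's) \<Rightarrow> bool" where
  "causal d N T X tok st \<longleftrightarrow>
     (\<forall>i\<in>{1..N}. indep_rvs (messages d N) (\<lambda>m. m) (X i 0)) \<and>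
     (\<forall>t<T. determined_on (messages d N) (X 0 (Suc t)) (X 0 t)) \<and>
     (\<forall>t<T. \<forall>i<N. determined_on {m \<in> messages d N. length (tok m t) = i}
        (\<lambda>m. (X (Suc i) (Suc t) m, crosses tok i t m)) (\<lambda>m. (X i t m, X (Suc i) t m))) \<and>
     (\<forall>t\<le>T. \<forall>i\<le>N. determined_on {m \<in> messages d N. length (tok m t) = i}
        (\<lambda>m. st m t) (X i t))"

text \<open>Conditional mutual information, in bits, of finite-valued random variables.\<close>

definition cond_mutual_info ::
  "msg set \<Rightarrow> (msg \<Rightarrow> 'a) \<Rightarrow> (msg \<Rightarrow> 'b) \<Rightarrow> (msg \<Rightarrow> 'c) \<Rightarrow> real" where
  "cond_mutual_info A X Y Z =
     prob_space.conditional_mutual_information (uniform_count_measure A) 2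
       (count_space (X ` A)) (count_space (Y ` A)) (count_space (Z ` A)) X Y Z"

text \<open>Finite-rate communication with capacities \<open>cap i\<close>. The capacity bound applies as soon as
  some message makes the token cross at that time; the state is unchanged on every message
  for which it does not cross.\<close>

definition finite_rate ::
  "nat \<Rightarrow> nat \<Rightarrow> nat \<Rightarrow> (nat \<Rightarrow> real) \<Rightarrow> (nat \<Rightarrow> nat \<Rightarrow> msg \<Rightarrow> 'x) \<Rightarrow>
   (msg \<Rightarrow> nat \<Rightarrow> nat list) \<Rightarrow> bool" where
  "finite_rate d N T cap X tok \<longleftrightarrow> (\<forall>t<T. \<forall>i<N.
     ((\<exists>m\<in>messages d N. crosses tok i t m) \<longrightarrow>
        cond_mutual_info (messages d N) (\<lambda>m. m) (X (Suc i) (Suc t)) (X (Suc i) t) \<le> cap i) \<and>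
     (\<forall>m\<in>messages d N. \<not> crosses tok i t m \<longrightarrow> X (Suc i) (Suc t) m = X (Suc i) t m))"

definition valid_execution ::
  "nat \<Rightarrow> 's htr \<Rightarrow> nat \<Rightarrow> nat \<Rightarrow> (nat \<Rightarrow> real) \<Rightarrow> (nat \<Rightarrow> nat \<Rightarrow> msg \<Rightarrow> 'x) \<Rightarrow>
   (msg \<Rightarrow> nat \<Rightarrow> nat list) \<Rightarrow> (msg \<Rightarrow> nat \<Rightarrow> 's) \<Rightarrow> bool" where
  "valid_execution d P N T cap X tok st \<longleftrightarrow>
     token_run d P N T tok st \<and> causal d N T X tok st \<and> finite_rate d N T cap X tok"

definition error_prob :: "nat \<Rightarrow> nat \<Rightarrow> (msg \<Rightarrow> 'x) \<Rightarrow> ('x \<Rightarrow> msg) \<Rightarrow> real" where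
  "error_prob d N Y est =
     measure (uniform_count_measure (messages d N)) {m \<in> messages d N. est (Y m) \<noteq> m}"


section \<open>Implementation by circuits\<close>

definition layer_values :: "circuit \<Rightarrow> nat \<Rightarrow> bool list \<Rightarrow> bool list" where
  "layer_values C t x =
     map (\<lambda>g. gate_values C x ! g) (filter (\<lambda>g. gate_depths C ! g = t) [0..<length C])"

text \<open>Every gate belongs to the agents of one level, given by \<open>own\<close>; the state of level \<open>i\<close> at
  time \<open>t\<close> consists of the values of its gates in layer \<open>t\<close>.\<close>

definition level_state ::
  "circuit \<Rightarrow> (nat \<Rightarrow> nat) \<Rightarrow> nat \<Rightarrow> nat \<Rightarrow> bool list \<Rightarrow> bool list" where
  "level_state C own i t x =
     map (\<lambda>g. gate_values C x ! g)
       (filter (\<lambda>g. gate_depths C ! g = t \<and> own g = i) [0..<length C])"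

text \<open>All existential data may depend on \<open>N\<close>; the capacities are \<open>log d + O(1)\<close> uniformly in
  \<open>N\<close> and \<open>i\<close>. Layer \<open>t\<close> of the circuit has to encode the position of the token at time \<open>t\<close>.\<close>

definition implements_htr :: "nat \<Rightarrow> 's htr \<Rightarrow> (nat \<Rightarrow> circuit) \<Rightarrow> bool" where
  "implements_htr d P C \<longleftrightarrow>
    (\<exists>(T :: nat \<Rightarrow> nat) (cap :: nat \<Rightarrow> nat \<Rightarrow> real) (own :: nat \<Rightarrow> nat \<Rightarrow> nat)
      (tok :: nat \<Rightarrow> msg \<Rightarrow> nat \<Rightarrow> nat list) (st :: nat \<Rightarrow> msg \<Rightarrow> nat \<Rightarrow> 's)
      (est :: nat \<Rightarrow> bool list \<Rightarrow> msg).
      let circ = (\<lambda>N. C (input_length d N));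
          X = (\<lambda>N i t m. level_state (circ N) (own N) i t (encoding d m))
      in
        (\<exists>K. \<forall>N. \<forall>i<N. \<bar>cap N i - log 2 (real d)\<bar> \<le> K) \<and>
        (\<forall>N\<ge>1. layered (circ N) \<and> T N \<le> depth (circ N) \<and>
           valid_execution d P N (T N) (cap N) (X N) (tok N) (st N) \<and>
           (\<forall>t\<le>T N. determined_on (messages d N) (\<lambda>m. tok N m t)
              (\<lambda>m. layer_values (circ N) t (encoding d m)))) \<and>
        (\<lambda>N. error_prob d N (X N N (T N)) (est N)) \<longlonglongrightarrow> 0)"

end

theory Submission
  imports Defs "HOL-Real_Asymp.Real_Asymp"
begin

text \<open>In one unit of time the token descends by at most one level, so a token that has reached
  level \<open>N\<close> has been travelling for at least \<open>N\<close> units (\<open>token_level_le_time\<close>). The point is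
  therefore that an execution whose last level can tell the message must bring the token there
  on at least one message. Otherwise the boundary into level \<open>N\<close> is never crossed, and the state
  of that level stays what it was at time 0, when it was independent of the message. But the only
  functions of a uniformly distributed message that are independent of it are the constant ones
  (\<open>indep_of_uniform_imp_constant\<close>), and a constant guess is wrong with probability at least
  \<open>1 - 1/d^N \<ge> 1/2\<close>. Hence every execution with error below \<open>1/2\<close> lasts at least \<open>N\<close> units
  (\<open>reliable_execution_takes_linear_time\<close>).

  An implementing circuit family has vanishing error, so its depth on instances of depth \<open>N\<close> is
  eventually at least \<open>N\<close>, whereas every polylogarithm is eventually smaller than \<open>N\<close>. For
  \<open>NC\<close> the depth is polylogarithmic in the input length, which is linear in \<open>N\<close>; this gives
  the same growth in \<open>N\<close>.\<close>

lemma finite_messages: "finite (messages d N)"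
  and card_messages: "card (messages d N) = d ^ N"
proof -
  have eq: "messages d N = {m. set m \<subseteq> {..<d} \<and> length m = N}"
    by (auto simp: messages_def)
  show "finite (messages d N)"
    unfolding eq by (rule finite_lists_length_eq) simp
  show "card (messages d N) = d ^ N"
    unfolding eq by (subst card_lists_length_eq) simp_all
qed

text \<open>Compare the event that the point drawn is \<open>a\<close> with the event that \<open>Z\<close> takes the value
  \<open>Z a\<close>: the first is contained in the second and has positive probability, so the product rule
  forces the second to have probability 1. Under the uniform distribution this leaves no
  exceptional points.\<close>

lemma indep_of_uniform_imp_constant:
  assumes fin: "finite A" and indep: "indep_rvs A (\<lambda>m. m) Z"
    and a: "a \<in> A" and b: "b \<in> A"
  shows "Z b = Z a"
proof -
  interpret prob_space "uniform_count_measure A"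
    using fin a by (intro prob_space_uniform_count_measure) auto
  define E where "E = Z -` {Z a} \<inter> A"
  have pr: "prob B = real (card B) / real (card A)" if "B \<subseteq> A" for B
    using measure_uniform_count_measure[OF fin that] .
  have pos: "card A > 0" using fin a by (auto simp: card_gt_0_iff)
  have E: "E \<subseteq> A" by (auto simp: E_def)
  have "indep_set {(\<lambda>m. m) -` B \<inter> A |B. True} {Z -` B \<inter> A |B. True}"
    using indep by (simp add: indep_rvs_def)
  moreover have "{a} \<in> {(\<lambda>m. m) -` B \<inter> A |B. True}"
    using a by blast
  moreover have "E \<in> {Z -` B \<inter> A |B. True}"
    unfolding E_def by blast
  ultimately have "prob ({a} \<inter> E) = prob {a} * prob E"
    by (rule indep_setD)
  moreover have "{a} \<inter> E = {a}" using a by (auto simp: E_def)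
  moreover have "prob {a} = 1 / real (card A)" using pr[of "{a}"] a by simp
  moreover have "prob E = real (card E) / real (card A)" using pr[OF E] .
  ultimately have "1 / real (card A) = 1 / real (card A) * (real (card E) / real (card A))"
    by (simp only:)
  hence "card E = card A" using pos by (simp add: field_simps)
  hence "E = A" by (intro card_subset_eq fin E)
  thus ?thesis using b by (auto simp: E_def)
qed

lemma error_prob_constant_guess:
  assumes d: "d \<ge> 2" and N: "N \<ge> 1"
    and const: "\<And>m m'. m \<in> messages d N \<Longrightarrow> m' \<in> messages d N \<Longrightarrow> Y m = Y m'"
  shows "error_prob d N Y est \<ge> 1/2"
proof -
  let ?A = "messages d N"
  have "d ^ 1 \<le> d ^ N" using d N by (intro power_increasing) auto
  hence card2: "card ?A \<ge> 2" using d by (simp add: card_messages)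
  obtain m0 where m0: "m0 \<in> ?A"
    using card2 by fastforce
  define wrong where "wrong = {m \<in> ?A. est (Y m) \<noteq> m}"
  have "est (Y m) = est (Y m0)" if "m \<in> ?A" for m
    using const[OF that m0] by (rule arg_cong)
  hence "?A - {est (Y m0)} \<subseteq> wrong"
    by (auto simp: wrong_def)
  moreover have "finite wrong" and sub: "wrong \<subseteq> ?A"
    using finite_messages[of d N] by (auto simp: wrong_def)
  ultimately have "card (?A - {est (Y m0)}) \<le> card wrong"
    by (intro card_mono)
  moreover have "card ?A - 1 \<le> card (?A - {est (Y m0)})"
    using diff_card_le_card_Diff[of "{est (Y m0)}" ?A] by simp
  ultimately have "card ?A \<le> 2 * card wrong"
    using card2 by linarith
  hence "1 / 2 \<le> real (card wrong) / real (card ?A)"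
    using card2 by (simp add: field_simps)
  also have "\<dots> = error_prob d N Y est"
    unfolding error_prob_def wrong_def[symmetric]
    by (rule measure_uniform_count_measure[OF finite_messages sub, symmetric])
  finally show ?thesis .
qed

lemma token_level_le_time:
  assumes run: "token_run d P N T tok st" and m: "m \<in> messages d N" and "t \<le> T"
  shows "length (tok m t) \<le> t"
  using \<open>t \<le> T\<close>
proof (induction t)
  case 0
  thus ?case using run m by (auto simp: token_run_def)
next
  case (Suc t)
  have "\<forall>t<T. tok m (Suc t) = tok m t \<or> tok m (Suc t) = tok m t @ [m ! length (tok m t)]"
    using run m by (simp add: token_run_def Let_def) metis
  hence "tok m (Suc t) = tok m t \<or> tok m (Suc t) = tok m t @ [m ! length (tok m t)]"
    using Suc.prems by simp
  thus ?case using Suc by auto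
qed

text \<open>In an execution shorter than \<open>N\<close> the token never enters level \<open>N\<close>, so the guess is based
  on the initial state of that level, which carries no information about the message.\<close>

lemma reliable_execution_takes_linear_time:
  assumes d: "d \<ge> 2" and N: "N \<ge> 1"
    and ex: "valid_execution d P N T cap X tok st"
    and err: "error_prob d N (X N T) est < 1/2"
  shows "N \<le> T"
proof (rule ccontr)
  assume "\<not> N \<le> T"
  let ?A = "messages d N"
  obtain i where i: "N = Suc i" using N by (cases N) auto
  have run: "token_run d P N T tok st" and caus: "causal d N T X tok st"
    and rate: "finite_rate d N T cap X tok"
    using ex by (auto simp: valid_execution_def)
  have no_cross: "\<not> crosses tok i t m" if "t < T" "m \<in> ?A" for t m
    using token_level_le_time[OF run that(2), of "Suc t"] that(1) \<open>\<not> N \<le> T\<close> i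
    by (auto simp: crosses_def)
  have unchanged: "X N t m = X N 0 m" if "t \<le> T" "m \<in> ?A" for t m
    using that(1)
  proof (induction t)
    case (Suc t)
    have "X N (Suc t) m = X N t m"
      using rate no_cross[of t m] Suc.prems that(2) i by (auto simp: finite_rate_def)
    with Suc show ?case by simp
  qed simp
  have "indep_rvs ?A (\<lambda>m. m) (X N 0)"
    using caus N by (auto simp: causal_def)
  hence "X N T m = X N T m'" if "m \<in> ?A" "m' \<in> ?A" for m m'
    using indep_of_uniform_imp_constant[OF finite_messages _ that(2,1)]
      unchanged[of T m] unchanged[of T m'] that by simp
  hence "error_prob d N (X N T) est \<ge> 1/2"
    by (rule error_prob_constant_guess[OF d N])
  with err show False by linarith
qed

lemma implements_htr_linear_depth:
  assumes d: "d \<ge> 2" and impl: "implements_htr d P C"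
  shows "eventually (\<lambda>N. N \<le> depth (C (input_length d N))) sequentially"
  using impl unfolding implements_htr_def Let_def
proof (elim exE conjE)
  fix T cap own tok st est
  assume impl': "\<forall>N\<ge>1. layered (C (input_length d N)) \<and> T N \<le> depth (C (input_length d N)) \<and>
      valid_execution d P N (T N) (cap N)
        (\<lambda>i t m. level_state (C (input_length d N)) (own N) i t (encoding d m)) (tok N) (st N) \<and>
      (\<forall>t\<le>T N. determined_on (messages d N) (\<lambda>m. tok N m t)
        (\<lambda>m. layer_values (C (input_length d N)) t (encoding d m)))"
    and err: "(\<lambda>N. error_prob d N
        (\<lambda>m. level_state (C (input_length d N)) (own N) N (T N) (encoding d m)) (est N))
        \<longlonglongrightarrow> 0"
  have ex: "T N \<le> depth (C (input_length d N)) \<and>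
      valid_execution d P N (T N) (cap N)
        (\<lambda>i t m. level_state (C (input_length d N)) (own N) i t (encoding d m)) (tok N) (st N)"
    if "N \<ge> 1" for N
    using impl'[rule_format, OF that] by (elim conjE) (intro conjI)
  have "eventually (\<lambda>N. error_prob d N
        (\<lambda>m. level_state (C (input_length d N)) (own N) N (T N) (encoding d m)) (est N) < 1/2)
        sequentially"
    using err by (rule order_tendstoD) simp
  with eventually_ge_at_top[of 1] show ?thesis
  proof eventually_elim
    case (elim N)
    have "N \<le> T N"
      using reliable_execution_takes_linear_time[OF d elim(1) conjunct2[OF ex[OF elim(1)]] elim(2)] .
    also have "\<dots> \<le> depth (C (input_length d N))" using ex[OF elim(1)] by blast
    finally show ?case .
  qed
qed

lemma polylog_not_linear:
  assumes "polylog D"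
  shows "\<not> eventually (\<lambda>N. N \<le> D N) sequentially"
proof
  assume ge: "eventually (\<lambda>N. N \<le> D N) sequentially"
  obtain k where "(\<lambda>n. real (D n)) \<in> O(\<lambda>n. ln (real n) ^ k)"
    using assms by (auto simp: polylog_def)
  moreover have "(\<lambda>n. ln (real n) ^ k) \<in> o(\<lambda>n. real n)"
    by real_asymp
  moreover have "(\<lambda>n. real n) \<in> O(\<lambda>n. real (D n))"
    using ge by (intro landau_o.big_mono) (auto elim: eventually_mono)
  ultimately have "(\<lambda>n. real n) \<in> o(\<lambda>n. real n)"
    by (meson landau_o.big_small_trans landau_o.big_trans)
  hence "eventually (\<lambda>n. real n = 0) sequentially"
    by (simp add: landau_o.small_refl_iff)
  with eventually_gt_at_top[of 0] have "eventually (\<lambda>n::nat. False) sequentially"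
    by eventually_elim simp
  thus False by simp
qed

text \<open>For \<open>d \<ge> 2\<close> each routing step takes at least one input bit, so the input length tends to
  infinity and asymptotic bounds may be composed with it; being linear in \<open>N\<close>, it has a logarithm
  of order \<open>ln N\<close>.\<close>

lemma polylog_input_length:
  assumes d: "d \<ge> 2" and D: "polylog D"
  shows "polylog (\<lambda>N. D (input_length d N))"
proof -
  obtain k where k: "(\<lambda>n. real (D n)) \<in> O(\<lambda>n. ln (real n) ^ k)"
    using D by (auto simp: polylog_def)
  define w where "w = real (width d)"
  have "log 2 (real d) \<ge> 1" using d by (simp add: le_log_iff)
  hence "width d \<ge> 1" unfolding width_def by linarith
  hence w: "w > 0" by (simp add: w_def)
  have "N \<le> input_length d N" for N
    using mult_le_mono2[OF \<open>width d \<ge> 1\<close>, of N] unfolding input_length_def by linarith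
  hence "filterlim (input_length d) at_top sequentially"
    by (intro filterlim_at_top_mono[OF filterlim_ident]) auto
  from landau_o.big.compose[OF k this]
  have "(\<lambda>N. real (D (input_length d N))) \<in> O(\<lambda>N. ln (real (input_length d N)) ^ k)" .
  also have "(\<lambda>N. ln (real (input_length d N)) ^ k) = (\<lambda>N. ln (1 + real N * w) ^ k)"
    by (simp add: input_length_def w_def)
  also have "\<dots> \<in> O(\<lambda>N. ln (real N) ^ k)"
  proof (rule landau_o.big_power)
    show "(\<lambda>N. ln (1 + real N * w)) \<in> O(\<lambda>N. ln (real N))"
      using w by real_asymp
  qed
  finally show ?thesis by (auto simp: polylog_def)
qed

theorem theorem4p1:
  fixes d :: nat and P :: "'s htr"
  assumes "d \<ge> 2" and "htr_process d P"
  shows "(\<nexists>C. standard_family C \<and> polylog (\<lambda>N. depth (C (input_length d N))) \<and>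
              implements_htr d P C) \<and>
         (\<nexists>C. NC_family C \<and> implements_htr d P C)"
proof -
  have main: False
    if "polylog (\<lambda>N. depth (C (input_length d N)))" "implements_htr d P C" for C
    using polylog_not_linear[OF that(1)]
      implements_htr_linear_depth[OF assms(1) that(2)] by simp
  moreover have "polylog (\<lambda>N. depth (C (input_length d N)))" if "NC_family C" for C
    using polylog_input_length[OF assms(1), of "\<lambda>n. depth (C n)"] that
    by (simp add: NC_family_def)
  ultimately show ?thesis by blast
qed

end
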